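(* Let $n\ge 2$, let $S$ be a closed orientable surface and let $\langle f,h\rangle$ be a representation of $BS(1,n)$ in $\mathrm{Homeo}(S)$, i.e. $f,h\in\mathrm{Homeo}(S)$ with $h\circ f\circ h^{-1}=f^n$. Suppose that for any $f$-invariant Borel probability measure $\mu$ on $S$ one has $\mathrm{supp}(\mu)\subset\mathrm{fix}(f)$. Then: (1) Any $f$-minimal set is a fixed point of $f$ (i.e. a singleton $\{x\}$ with $f(x)=x$). The set $\mathrm{per}(f)$ of periodic points of $f$ coincides with $\mathrm{fix}(f)$. (2) Any $BS$-minimal set is included in $\mathrm{fix}(f)$. Moreover, any $BS$-minimal set coincides with an $h$-minimal set in $\mathrm{fix}(f)$. (3) The topological entropy of $f$ is $\mathrm{ent}_{top}(f)=0$.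
   Context: $BS(1,n)=\langle a,b\mid aba^{-1}=b^n\rangle$; in $\langle f,h\rangle$, $b$ acts by $f$ and $a$ by $h$ (the representation need not be faithful). $\mathrm{fix}(f)$ is the set of fixed points of $f$. A minimal set of an action of a group $G$ on a compact metric space $X$ is a non-empty closed $G$-invariant subset $M\subset X$ such that any closed $G$-invariant $K\subset M$ satisfies $K=M$ or $K=\emptyset$. An $f$-minimal (resp. $h$-minimal, $BS$-minimal) set is a minimal set of the action of the group generated by $f$ (resp. by $h$, by $f$ and $h$). *)

theory Defs
  imports "HOL-Homology.Homology" "HOL-Probability.Probability_Measure" "HOL-Algebra.Bij"
    "HOL-Algebra.Generated_Groups"
begin

text \<open>Spaces are subsets \<open>S\<close> of a metric space, with the induced metric and topology, and a
  self-map of \<open>S\<close> is a function on the ambient type of which only the values on \<open>S\<close> matter.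
  Every closed surface is metrizable, so it occurs in this form.\<close>

section \<open>Closed orientable surfaces\<close>

text \<open>Hausdorffness and second countability follow from being compact and metric.\<close>

definition closed_surface :: "'a::metric_space set \<Rightarrow> bool" where
  "closed_surface S \<longleftrightarrow>
     compact S \<and> connected S \<and> S \<noteq> {} \<and>
     (\<forall>x\<in>S. \<exists>U (V :: (real^2) set).
        openin (top_of_set S) U \<and> x \<in> U \<and> open V \<and> U homeomorphic V)"

text \<open>An orientation is a choice of a generator of the infinite cyclic local homology group
  \<open>H\<^sub>2(S, S - {x})\<close> at each \<open>x\<close>, such that near every point these generators are the
  restrictions of a single class in \<open>H\<^sub>2(S, S - U)\<close>.\<close>

definition orientation_on :: "'a::metric_space set \<Rightarrow> ('a \<Rightarrow> 'a chain set) \<Rightarrow> bool" where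
  "orientation_on S \<omega> \<longleftrightarrow>
     (\<forall>x\<in>S. \<omega> x \<in> carrier (relative_homology_group 2 (top_of_set S) (S - {x})) \<and>
        generate (relative_homology_group 2 (top_of_set S) (S - {x})) {\<omega> x}
          = carrier (relative_homology_group 2 (top_of_set S) (S - {x}))) \<and>
     (\<forall>x\<in>S. \<exists>U. openin (top_of_set S) U \<and> x \<in> U \<and>
        (\<exists>c \<in> carrier (relative_homology_group 2 (top_of_set S) (S - U)).
           \<forall>y\<in>U. hom_induced 2 (top_of_set S) (S - U) (top_of_set S) (S - {y}) id c = \<omega> y))"

definition orientable :: "'a::metric_space set \<Rightarrow> bool" where
  "orientable S \<longleftrightarrow> (\<exists>\<omega>. orientation_on S \<omega>)"

section \<open>Fixed points, periodic points and minimal sets\<close>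

definition fixed_points :: "'a set \<Rightarrow> ('a \<Rightarrow> 'a) \<Rightarrow> 'a set" where
  "fixed_points S f = {x \<in> S. f x = x}"

definition periodic_points :: "'a set \<Rightarrow> ('a \<Rightarrow> 'a) \<Rightarrow> 'a set" where
  "periodic_points S f = {x \<in> S. \<exists>k>0. (f ^^ k) x = x}"

text \<open>Elements of \<^const>\<open>BijGroup\<close> are extensional, hence the restriction of the generators.\<close>

definition generated_homeos :: "'a set \<Rightarrow> ('a \<Rightarrow> 'a) set \<Rightarrow> ('a \<Rightarrow> 'a) set" where
  "generated_homeos S F = generate (BijGroup S) ((\<lambda>g. restrict g S) ` F)"

definition invariant_under :: "('a \<Rightarrow> 'a) set \<Rightarrow> 'a set \<Rightarrow> bool" where
  "invariant_under G K \<longleftrightarrow> (\<forall>g\<in>G. g ` K = K)"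

definition minimal_set :: "'a::metric_space set \<Rightarrow> ('a \<Rightarrow> 'a) set \<Rightarrow> 'a set \<Rightarrow> bool" where
  "minimal_set S G M \<longleftrightarrow>
     M \<noteq> {} \<and> closedin (top_of_set S) M \<and> invariant_under G M \<and>
     (\<forall>K. K \<subseteq> M \<and> closedin (top_of_set S) K \<and> invariant_under G K \<longrightarrow> K = M \<or> K = {})"

section \<open>Invariant measures\<close>

definition invariant_prob :: "'a::metric_space set \<Rightarrow> ('a \<Rightarrow> 'a) \<Rightarrow> 'a measure \<Rightarrow> bool" where
  "invariant_prob S f \<mu> \<longleftrightarrow>
     prob_space \<mu> \<and> sets \<mu> = sets (restrict_space borel S) \<and>
     (\<forall>A \<in> sets \<mu>. emeasure \<mu> (f -` A \<inter> S) = emeasure \<mu> A)"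

definition measure_support :: "'a::metric_space set \<Rightarrow> 'a measure \<Rightarrow> 'a set" where
  "measure_support S \<mu> =
     {x \<in> S. \<forall>U. openin (top_of_set S) U \<and> x \<in> U \<longrightarrow> emeasure \<mu> U > 0}"

section \<open>Topological entropy\<close>

text \<open>Bowen's definition. Since \<open>entropy_at_scale S f \<epsilon>\<close> increases as \<open>\<epsilon>\<close> decreases to \<open>0\<close>, the
  supremum over \<open>\<epsilon> > 0\<close> is the usual limit.\<close>

definition separated_set ::
  "'a::metric_space set \<Rightarrow> ('a \<Rightarrow> 'a) \<Rightarrow> nat \<Rightarrow> real \<Rightarrow> 'a set \<Rightarrow> bool" where
  "separated_set S f n \<epsilon> E \<longleftrightarrow>
     E \<subseteq> S \<and> (\<forall>x\<in>E. \<forall>y\<in>E. x \<noteq> y \<longrightarrow> (\<exists>i<n. dist ((f ^^ i) x) ((f ^^ i) y) > \<epsilon>))"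

definition entropy_at_scale :: "'a::metric_space set \<Rightarrow> ('a \<Rightarrow> 'a) \<Rightarrow> real \<Rightarrow> ereal" where
  "entropy_at_scale S f \<epsilon> =
     limsup (\<lambda>n. SUP E \<in> {E. finite E \<and> E \<noteq> {} \<and> separated_set S f n \<epsilon> E}.
                   ereal (ln (real (card E)) / real n))"

definition topological_entropy :: "'a::metric_space set \<Rightarrow> ('a \<Rightarrow> 'a) \<Rightarrow> ereal" where
  "topological_entropy S f = (SUP \<epsilon> \<in> {0<..}. entropy_at_scale S f \<epsilon>)"

end

theory Submission
  imports Defs "HOL-Probability.Helly_Selection" "HOL-Probability.Probability_Mass_Function"
begin

text \<open>
  Everything follows from one property of \<open>f\<close>: its orbits drift slowly. If every invariant
  probability measure is carried by the fixed points, then the displacement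
  \<open>x \<mapsto> dist x (f x)\<close> has integral \<open>0\<close> for all of them, and therefore its averages along orbit
  segments tend to \<open>0\<close> uniformly in the starting point: otherwise the uniform measures on the
  segments violating this would accumulate at an invariant measure giving the displacement a
  positive integral (\<open>slowly_drifting_if_invariant_measures_on_fixed_points\<close>).

  The accumulation argument needs the weak compactness of the probability measures on the compact
  metric space \<open>S\<close>. It is transported from the real line, where it is Helly's selection theorem:
  \<open>S\<close> is a continuous image of a compact set of reals, so that measures are lifted to the line by
  choosing preimages, and weak limits are pushed forward to \<open>S\<close>.

  Slow drift gives the three parts as follows.

  (1) On a nonempty compact invariant set, a point at which the displacement is minimal has
  displacement \<open>0\<close>, since the averages along its orbit are at least that minimum. So every such set
  contains a fixed point. Minimal sets are therefore singletons, and periodic orbits are constant.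

  (2) The relation \<open>h f h\<inverse> = f^n\<close> and the equality of periodic and fixed points imply that the set of
  fixed points of \<open>f\<close> is invariant under \<open>h\<close>. It is closed and, by (1), meets every minimal set of the
  joint action, so it contains all of them. There \<open>f\<close> acts trivially, so that only the action of \<open>h\<close> remains.

  (3) An orbit segment is recorded up to \<open>\<epsilon>\<close> by a sequence of points of a finite net in which the
  current point is replaced only when the orbit has left its neighbourhood. Each replacement
  costs a fixed amount of path length, hence slow drift leaves only a small proportion of
  replacements, and the number of such sequences grows at an arbitrarily small exponential rate.
\<close>

section \<open>Compact metric spaces as continuous images of compact sets of reals\<close>

text \<open>The membership pattern of \<open>x\<close> in a sequence of sets, read as a number with base \<open>3\<close> digits
  \<open>0\<close> and \<open>1\<close> only. As in the Cantor set, leaving out a digit makes the reading of the digits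
  from the number stable under small perturbations.\<close>

definition membership_code :: "(nat \<Rightarrow> 'a set) \<Rightarrow> 'a \<Rightarrow> real" where
  "membership_code A x = suminf (\<lambda>j. indicator (A j) x * (1/3) ^ j)"

lemma membership_code_summable: "summable (\<lambda>j. indicator (A j) x * (1/3::real) ^ j)"
  by (rule summable_comparison_test'[OF summable_geometric[of "1/3::real"], of 0])
     (auto simp: indicator_def)

lemma membership_code_bounds: "membership_code A x \<in> {0..3/2}"
proof -
  have "membership_code A x \<le> suminf (\<lambda>j. (1/3::real) ^ j)"
    unfolding membership_code_def
    by (intro suminf_le membership_code_summable summable_geometric) (auto simp: indicator_def)
  also have "\<dots> = 3/2" by (subst suminf_geometric) auto
  finally show ?thesis
    unfolding membership_code_def by (auto intro!: suminf_nonneg membership_code_summable)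
qed

lemma membership_code_tail:
  "membership_code A x = (\<Sum>j<m. indicator (A j) x * (1/3) ^ j) + (1/3) ^ m * membership_code (\<lambda>j. A (j + m)) x"
proof -
  have "membership_code A x = suminf (\<lambda>j. indicator (A (j + m)) x * (1/3) ^ (j + m))
      + (\<Sum>j<m. indicator (A j) x * (1/3) ^ j)"
    unfolding membership_code_def by (rule suminf_split_initial_segment[OF membership_code_summable])
  also have "suminf (\<lambda>j. indicator (A (j + m)) x * (1/3) ^ (j + m)) = (1/3) ^ m * membership_code (\<lambda>j. A (j + m)) x"
    unfolding membership_code_def
    by (subst suminf_mult[symmetric]) (auto intro!: membership_code_summable simp: power_add mult_ac)
  finally show ?thesis by simp
qed

text \<open>If the first disagreement is at digit \<open>k\<close>, it contributes \<open>1/3^k\<close> to the difference of the codes,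
  and by the bounds on codes all later digits together can cancel at most half of that.\<close>

lemma membership_code_separates:
  assumes close: "\<bar>membership_code A x - membership_code A y\<bar> < (1/3) ^ m / 2" and "i \<le> m"
  shows "x \<in> A i \<longleftrightarrow> y \<in> A i"
proof (rule ccontr)
  assume "\<not> (x \<in> A i \<longleftrightarrow> y \<in> A i)"
  define k where "k = (LEAST i. \<not> (x \<in> A i \<longleftrightarrow> y \<in> A i))"
  have k: "\<not> (x \<in> A k \<longleftrightarrow> y \<in> A k)"
    unfolding k_def by (rule LeastI) fact
  have "k \<le> m" using \<open>i \<le> m\<close> Least_le[of "\<lambda>i. \<not> (x \<in> A i \<longleftrightarrow> y \<in> A i)", OF \<open>\<not> (x \<in> A i \<longleftrightarrow> y \<in> A i)\<close>]
    unfolding k_def by linarith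
  have agree: "indicator (A j) x = (indicator (A j) y :: real)" if "j < k" for j
    using not_less_Least[of j "\<lambda>i. \<not> (x \<in> A i \<longleftrightarrow> y \<in> A i)"] that unfolding k_def
    by (auto simp: indicator_def)
  let ?B = "\<lambda>j. A (j + Suc k)"
  have "membership_code A x - membership_code A y = (indicator (A k) x - indicator (A k) y) * (1/3) ^ k
      + (1/3) ^ Suc k * (membership_code ?B x - membership_code ?B y)"
    using membership_code_tail[of A x "Suc k"] membership_code_tail[of A y "Suc k"]
      sum.cong[OF refl, of "{..<k}" "\<lambda>j. indicator (A j) x * (1/3::real) ^ j"
        "\<lambda>j. indicator (A j) y * (1/3) ^ j"] agree
    by (simp add: left_diff_distrib right_diff_distrib)
  also have "\<dots> = (1/3) ^ k * ((indicator (A k) x - indicator (A k) y) + (membership_code ?B x - membership_code ?B y) / 3)"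
    by (simp add: field_simps)
  finally have "\<bar>membership_code A x - membership_code A y\<bar>
      = (1/3) ^ k * \<bar>(indicator (A k) x - indicator (A k) y) + (membership_code ?B x - membership_code ?B y) / 3\<bar>"
    by (simp add: abs_mult)
  also have "\<dots> \<ge> (1/3) ^ k * (1/2)"
  proof -
    have "1/2 \<le> \<bar>s + (u - v) / 3\<bar>"
      if "s = 1 \<or> s = -1" "u \<in> {0..3/2}" "v \<in> {0..3/2}" for s u v :: real
      using that by (elim disjE; simp add: abs_if field_simps)
    then show ?thesis
      using k membership_code_bounds[of ?B x] membership_code_bounds[of ?B y]
      by (intro mult_left_mono) (auto simp: indicator_def)
  qed
  also have "(1/3::real) ^ k * (1/2) \<ge> (1/3) ^ m / 2"
    using \<open>k \<le> m\<close> by (simp add: power_decreasing)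
  finally show False using close by linarith
qed

text \<open>Take all the balls of finite covers with radii \<open>1, 1/2, 1/3, \<dots>\<close> for the sets. Points
  whose codes are close agree on the balls of the first few covers, hence share a small ball.
  The code itself is not continuous in general; only its inverse is uniformly so.\<close>

lemma compact_uniformly_invertible_code:
  fixes S :: "'a::metric_space set"
  assumes "compact S"
  obtains t :: "'a \<Rightarrow> real" where "range t \<subseteq> {0..3/2}"
    and "\<And>e. e > 0 \<Longrightarrow> \<exists>d>0. \<forall>x\<in>S. \<forall>y\<in>S. \<bar>t x - t y\<bar> < d \<longrightarrow> dist x y < e"
proof -
  have "\<exists>F. finite F \<and> S \<subseteq> (\<Union>p\<in>F. ball p (1 / real (Suc m)))" for m
    using assms unfolding compact_eq_totally_bounded by simp
  then obtain F where F: "\<And>m. finite (F m)" "\<And>m. S \<subseteq> (\<Union>p\<in>F m. ball p (1 / real (Suc m)))"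
    by metis
  \<comment> \<open>The empty set is added because only a nonempty countable family is the range of its enumeration.\<close>
  define \<A> where "\<A> = (\<Union>m. (\<lambda>p. ball p (1 / real (Suc m))) ` F m) \<union> {{}}"
  have "countable \<A>" unfolding \<A>_def using F(1) by (simp add: countable_finite)
  have "\<A> \<noteq> {}" unfolding \<A>_def by auto
  define A where "A = from_nat_into \<A>"
  have range_A: "range A = \<A>"
    unfolding A_def using \<open>countable \<A>\<close> \<open>\<A> \<noteq> {}\<close> by (rule range_from_nat_into[rotated])
  show ?thesis
  proof (rule that[of "membership_code A"])
    show "range (membership_code A) \<subseteq> {0..3/2}" using membership_code_bounds by (rule image_subsetI)
    fix e :: real assume "e > 0"
    then obtain m where m: "1 / real (Suc m) < e / 2"
      using nat_approx_posE[of "e / 2"] by (auto simp: field_simps)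
    have "ball p (1 / real (Suc m)) \<in> range A" if "p \<in> F m" for p
      unfolding range_A \<A>_def using that by blast
    then have "\<forall>p\<in>F m. \<exists>i. A i = ball p (1 / real (Suc m))" by (auto simp: image_iff eq_commute)
    then obtain i where i: "\<And>p. p \<in> F m \<Longrightarrow> A (i p) = ball p (1 / real (Suc m))" by metis
    define k where "k = Max (insert 0 (i ` F m))"
    have "dist x y < e" if "x \<in> S" "y \<in> S" "\<bar>membership_code A x - membership_code A y\<bar> < (1/3) ^ k / 2" for x y
    proof -
      obtain p where p: "p \<in> F m" "x \<in> ball p (1 / real (Suc m))" using F(2) \<open>x \<in> S\<close> by blast
      have "i p \<le> k" unfolding k_def using p F(1) by (intro Max_ge) auto
      then have "y \<in> ball p (1 / real (Suc m))"
        using membership_code_separates[OF that(3), of "i p"] p i by auto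
      then show "dist x y < e" using p m dist_triangle3[of x y p] by simp
    qed
    then show "\<exists>d>0. \<forall>x\<in>S. \<forall>y\<in>S. \<bar>membership_code A x - membership_code A y\<bar> < d \<longrightarrow> dist x y < e"
      by (intro exI[of _ "(1/3) ^ k / 2"]) auto
  qed
qed

text \<open>A form of the theorem of Alexandroff and Hausdorff. The closure of the graph of a code with
  uniformly continuous inverse is compact, and uniform continuity makes its projection to the real
  line injective; a continuous injection of a compact set has a continuous inverse, so the other
  projection becomes a continuous function of the code.\<close>

theorem compact_metric_continuous_image_of_real_compact:
  fixes S :: "'a::metric_space set"
  assumes "compact S"
  obtains C :: "real set" and \<pi> t where
    "compact C" "continuous_on C \<pi>" "\<pi> ` C \<subseteq> S" "t ` S \<subseteq> C" "\<And>x. x \<in> S \<Longrightarrow> \<pi> (t x) = x"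
proof -
  obtain t :: "'a \<Rightarrow> real" where range_t: "range t \<subseteq> {0..3/2}"
    and t: "\<And>e. e > 0 \<Longrightarrow> \<exists>d>0. \<forall>x\<in>S. \<forall>y\<in>S. \<bar>t x - t y\<bar> < d \<longrightarrow> dist x y < e"
    using compact_uniformly_invertible_code[OF assms] by blast
  define \<Gamma> where "\<Gamma> = closure ((\<lambda>x. (t x, x)) ` S)"
  have "compact ({0..3/2::real} \<times> S)" using assms by (intro compact_Times) auto
  moreover have \<Gamma>_sub: "\<Gamma> \<subseteq> {0..3/2} \<times> S"
    unfolding \<Gamma>_def using range_t calculation
    by (intro closure_minimal compact_imp_closed) auto
  moreover have "compact (({0..3/2} \<times> S) \<inter> \<Gamma>)"
    unfolding \<Gamma>_def by (intro compact_Int_closed calculation(1) closed_closure)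
  ultimately have "compact \<Gamma>" by (simp add: Int_absorb1)
  have "inj_on fst \<Gamma>"
  proof (rule inj_onI)
    fix u v assume uv: "u \<in> \<Gamma>" "v \<in> \<Gamma>" "fst u = fst v"
    have "dist (snd u) (snd v) \<le> 0 + e" if "e > 0" for e
    proof -
      obtain d where d: "d > 0" "\<And>x y. x \<in> S \<Longrightarrow> y \<in> S \<Longrightarrow> \<bar>t x - t y\<bar> < d \<Longrightarrow> dist x y < e / 3"
        using t[of "e / 3"] \<open>e > 0\<close> by auto
      have pos: "min (d / 2) (e / 3) > 0" using d \<open>e > 0\<close> by simp
      obtain x where x: "x \<in> S" "dist (t x, x) u < min (d / 2) (e / 3)"
        using uv(1) pos unfolding \<Gamma>_def closure_approachable by blast
      obtain y where y: "y \<in> S" "dist (t y, y) v < min (d / 2) (e / 3)"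
        using uv(2) pos unfolding \<Gamma>_def closure_approachable by blast
      note fsts = dist_fst_le[of "(t x, x)" u] dist_fst_le[of "(t y, y)" v]
      note snds = dist_snd_le[of "(t x, x)" u] dist_snd_le[of "(t y, y)" v]
      have "\<bar>t x - t y\<bar> < d" using fsts x y uv(3) by (auto simp: dist_real_def)
      then have "dist x y < e / 3" using d x y by blast
      then show ?thesis using snds x y dist_triangle3[of "snd u" "snd v" x] dist_triangle[of x "snd v" y]
        by auto
    qed
    then have "dist (snd u) (snd v) \<le> 0" by (rule field_le_epsilon)
    then show "u = v" using uv by (simp add: prod_eq_iff)
  qed
  show ?thesis
  proof (rule that[of "fst ` \<Gamma>" "snd \<circ> inv_into \<Gamma> fst" t])
    show "compact (fst ` \<Gamma>)" using \<open>compact \<Gamma>\<close>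
      by (intro compact_continuous_image continuous_on_fst continuous_on_id)
    have "continuous_on (fst ` \<Gamma>) (inv_into \<Gamma> fst)"
      using \<open>compact \<Gamma>\<close> \<open>inj_on fst \<Gamma>\<close>
      by (intro continuous_on_inv continuous_on_fst continuous_on_id) auto
    then show "continuous_on (fst ` \<Gamma>) (snd \<circ> inv_into \<Gamma> fst)"
      by (intro continuous_on_compose continuous_on_snd continuous_on_id)
    show "(snd \<circ> inv_into \<Gamma> fst) ` fst ` \<Gamma> \<subseteq> S"
    proof (rule image_subsetI)
      fix c assume "c \<in> fst ` \<Gamma>"
      then have "inv_into \<Gamma> fst c \<in> {0..3/2} \<times> S" using \<Gamma>_sub inv_into_into[of c fst \<Gamma>] by blast
      then show "(snd \<circ> inv_into \<Gamma> fst) c \<in> S" by (simp add: mem_Times_iff)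
    qed
    have graph: "(t x, x) \<in> \<Gamma>" if "x \<in> S" for x
      unfolding \<Gamma>_def using that closure_subset by fast
    then show "t ` S \<subseteq> fst ` \<Gamma>" by force
    show "(snd \<circ> inv_into \<Gamma> fst) (t x) = x" if "x \<in> S" for x
      using inv_into_f_f[OF \<open>inj_on fst \<Gamma>\<close> graph[OF that]] by simp
  qed
qed

section \<open>Weak limits of orbit averages\<close>

text \<open>Prokhorov's theorem for uniform measures on finite families of points. The points are lifted to
  a compact set \<open>C\<close> of reals, where the lifted measures have a weakly convergent
  subsequence; the limit is carried by \<open>C\<close>, and its image under the projection of \<open>C\<close> onto \<open>S\<close>
  has the required integrals, since a continuous function on \<open>S\<close> pulls back to \<open>C\<close> and extends to
  the whole line.\<close>

lemma averages_subconverge_weakly: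
  fixes S :: "'a::metric_space set" and N :: "nat \<Rightarrow> nat" and p :: "nat \<Rightarrow> nat \<Rightarrow> 'a"
  assumes "compact S" and N: "\<And>j. N j > 0" and p: "\<And>j i. p j i \<in> S"
  obtains r \<mu> where "strict_mono (r :: nat \<Rightarrow> nat)" "prob_space \<mu>"
    "sets \<mu> = sets (restrict_space borel S)"
    "\<And>g :: 'a \<Rightarrow> real. continuous_on S g \<Longrightarrow>
       (\<lambda>j. (\<Sum>i<N (r j). g (p (r j) i)) / real (N (r j))) \<longlonglongrightarrow> (\<integral>x. g x \<partial>\<mu>)"
proof -
  obtain C :: "real set" and \<pi> t where C: "compact C" "continuous_on C \<pi>" "\<pi> ` C \<subseteq> S" "t ` S \<subseteq> C"
    and \<pi>t: "\<And>x. x \<in> S \<Longrightarrow> \<pi> (t x) = x"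
    using compact_metric_continuous_image_of_real_compact[OF assms(1)] by blast
  have tC: "t (p j i) \<in> C" for j i using C(4) p by blast
  have "closed C" using C(1) by (rule compact_imp_closed)
  define \<nu> where "\<nu> j = distr (measure_pmf (pmf_of_set {..<N j})) borel (\<lambda>i. t (p j i))" for j
  have rd: "real_distribution (\<nu> j)" for j
    unfolding \<nu>_def by (rule prob_space.real_distribution_distr[OF measure_pmf.prob_space_axioms]) simp
  have avg: "integral\<^sup>L (\<nu> j) G = (\<Sum>i<N j. G (t (p j i))) / real (N j)"
    if "G \<in> borel_measurable borel" for j and G :: "real \<Rightarrow> real"
  proof -
    have "{..<N j} \<noteq> {}" using N[of j] by auto
    then show ?thesis using that unfolding \<nu>_def by (simp add: integral_distr integral_pmf_of_set)
  qed
  obtain b where b: "\<And>y. y \<in> C \<Longrightarrow> \<bar>y\<bar> \<le> b"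
    using compact_imp_bounded[OF C(1)] unfolding bounded_iff by auto
  have "measure (\<nu> j) {-(\<bar>b\<bar> + 1)<..\<bar>b\<bar> + 1} = 1" for j
  proof -
    have "t (p j i) \<in> {-(\<bar>b\<bar> + 1)<..\<bar>b\<bar> + 1}" for i
      using b[OF tC[of j i]] by auto
    then have "(\<lambda>i. t (p j i)) -` {-(\<bar>b\<bar> + 1)<..\<bar>b\<bar> + 1} = UNIV" by blast
    then show ?thesis unfolding \<nu>_def by (simp add: measure_distr)
  qed
  then have "-(\<bar>b\<bar> + 1) < \<bar>b\<bar> + 1 \<and> (\<forall>j. 1 - \<epsilon> < measure (\<nu> j) {-(\<bar>b\<bar> + 1)<..\<bar>b\<bar> + 1})"
    if "\<epsilon> > 0" for \<epsilon> using that by simp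
  then have "tight \<nu>"
    unfolding tight_def using rd by blast
  then obtain r M where r: "strict_mono (r :: nat \<Rightarrow> nat)" and "real_distribution M"
    and conv: "weak_conv_m (\<nu> \<circ> id \<circ> r) M"
    using tight_imp_convergent_subsubsequence[OF _ strict_mono_id] by blast
  interpret M: real_distribution M by fact
  have lim: "(\<lambda>j. (\<Sum>i<N (r j). G (t (p (r j) i))) / real (N (r j))) \<longlonglongrightarrow> integral\<^sup>L M G"
    if G: "continuous_on UNIV G" "\<And>y. \<bar>G y\<bar> \<le> B" for G :: "real \<Rightarrow> real" and B
  proof -
    have "(\<lambda>j. integral\<^sup>L ((\<nu> \<circ> id \<circ> r) j) G) \<longlonglongrightarrow> integral\<^sup>L M G"
      using G rd by (intro weak_conv_imp_integral_bdd_continuous_conv[OF _ \<open>real_distribution M\<close> conv])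
        (auto simp: continuous_on_eq_continuous_at)
    then show ?thesis using avg[OF borel_measurable_continuous_onI[OF G(1)]] by simp
  qed
  have [measurable]: "C \<in> sets borel" using \<open>closed C\<close> by simp
  have "C \<noteq> {}" using tC by blast
  \<comment> \<open>Testing with the truncated distance to \<open>C\<close>, which vanishes on all lifted points.\<close>
  have AE_C: "AE y in M. y \<in> C"
  proof -
    let ?G = "\<lambda>y. min 1 (infdist y C)"
    have contG: "continuous_on UNIV ?G" by (intro continuous_intros)
    have "(\<lambda>j. (\<Sum>i<N (r j). ?G (t (p (r j) i))) / real (N (r j))) \<longlonglongrightarrow> integral\<^sup>L M ?G"
      by (intro lim[of _ 1] contG) (simp add: infdist_nonneg)
    moreover have "(\<Sum>i<N (r j). ?G (t (p (r j) i))) = 0" for j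
      using tC by (intro sum.neutral) (auto simp: infdist_nonneg)
    ultimately have "integral\<^sup>L M ?G = 0" by (simp add: LIMSEQ_const_iff)
    moreover have "integrable M ?G"
      using borel_measurable_continuous_onI[OF contG]
      by (intro M.integrable_const_bound[of _ 1]) (simp_all add: infdist_nonneg)
    ultimately have "AE y in M. ?G y = 0"
      by (subst (asm) integral_nonneg_eq_0_iff_AE) (auto simp: infdist_nonneg)
    then show ?thesis
      by eventually_elim
         (auto simp: min_def in_closed_iff_infdist_zero[OF \<open>closed C\<close> \<open>C \<noteq> {}\<close>] split: if_splits)
  qed
  \<comment> \<open>Off the null set \<open>- C\<close> any value in \<open>S\<close> will do.\<close>
  define q where "q y = (if y \<in> C then \<pi> y else p 0 0)" for y
  have "q \<in> borel_measurable borel"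
    unfolding q_def using C by (intro borel_measurable_continuous_on_if) auto
  then have q: "q \<in> measurable M (restrict_space borel S)"
    using C p by (intro measurable_restrict_space2) (auto simp: q_def image_subset_iff measurable_cong_sets[OF M.events_eq_borel refl])
  show ?thesis
  proof (rule that[OF r, of "distr M (restrict_space borel S) q"])
    show "prob_space (distr M (restrict_space borel S) q)" by (rule M.prob_space_distr[OF q])
    show "sets (distr M (restrict_space borel S) q) = sets (restrict_space borel S)" by simp
    fix g :: "'a \<Rightarrow> real" assume g: "continuous_on S g"
    have cont: "continuous_on C (g \<circ> \<pi>)"
      using C g by (intro continuous_on_compose continuous_on_subset[OF g]) auto
    obtain B where "B > 0" and B: "\<And>y. y \<in> C \<Longrightarrow> norm ((g \<circ> \<pi>) y) \<le> B"
      using compact_imp_bounded[OF compact_continuous_image[OF cont C(1)]] unfolding bounded_pos by auto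
    obtain G where G: "continuous_on UNIV G" "\<And>y. y \<in> C \<Longrightarrow> G y = (g \<circ> \<pi>) y" "\<And>y. norm (G y) \<le> B"
      using Tietze[of C "g \<circ> \<pi>" UNIV B] cont B \<open>closed C\<close> \<open>B > 0\<close> by (metis UNIV_I closed_closedin less_imp_le subtopology_UNIV)
    have gm: "g \<in> borel_measurable (restrict_space borel S)"
      using g by (rule borel_measurable_continuous_on_restrict)
    have "(\<integral>x. g x \<partial>distr M (restrict_space borel S) q) = (\<integral>y. g (q y) \<partial>M)"
      by (rule integral_distr[OF q gm])
    also have "\<dots> = integral\<^sup>L M G"
    proof (rule integral_cong_AE)
      show "(\<lambda>y. g (q y)) \<in> borel_measurable M" using measurable_compose[OF q gm] .
      show "G \<in> borel_measurable M"
        using borel_measurable_continuous_onI[OF G(1)] by (simp add: measurable_cong_sets[OF M.events_eq_borel refl])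
      show "AE y in M. g (q y) = G y" using AE_C by eventually_elim (simp add: q_def G)
    qed
    finally show "(\<lambda>j. (\<Sum>i<N (r j). g (p (r j) i)) / real (N (r j)))
        \<longlonglongrightarrow> (\<integral>x. g x \<partial>distr M (restrict_space borel S) q)"
      using lim[of G B] G tC \<pi>t p by simp
  qed
qed

text \<open>The functions \<open>max 0 (1 - k * infdist x A)\<close> decrease to the indicator of a nonempty closed set \<open>A\<close>, so the
  measures agree on closed sets, which generate the Borel sets.\<close>

lemma prob_space_eqI_continuous:
  fixes S :: "'a::metric_space set"
  assumes "compact S" "prob_space \<mu>" "prob_space \<mu>'"
    and sets: "sets \<mu> = sets (restrict_space borel S)" "sets \<mu>' = sets (restrict_space borel S)"
    and eq: "\<And>g :: 'a \<Rightarrow> real. continuous_on S g \<Longrightarrow> (\<integral>x. g x \<partial>\<mu>) = (\<integral>x. g x \<partial>\<mu>')"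
  shows "\<mu> = \<mu>'"
proof -
  interpret \<mu>: prob_space \<mu> by fact
  interpret \<mu>': prob_space \<mu>' by fact
  have "closed S" using assms(1) by (rule compact_imp_closed)
  have space: "space \<mu> = S" "space \<mu>' = S"
    using sets_eq_imp_space_eq[OF sets(1)] sets_eq_imp_space_eq[OF sets(2)]
    by (simp_all add: space_restrict_space)
  let ?E = "(\<inter>) S ` Collect closed"
  have "S \<in> sigma_sets UNIV (Collect closed)" using \<open>closed S\<close> by auto
  then have "sigma_sets S ?E = (\<inter>) S ` sigma_sets UNIV (Collect closed)"
    by (rule sigma_sets_Int[symmetric]) simp
  then have gen: "sets (restrict_space borel S) = sigma_sets S ?E"
    by (simp add: sets_restrict_space borel_eq_closed)
  have meas: "A \<in> sets \<nu>" if "A \<in> ?E" "sets \<nu> = sets (restrict_space borel S)" for A and \<nu> :: "'a measure"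
    using that unfolding gen by auto
  have lim: "(\<lambda>k. \<integral>x. max 0 (1 - real k * infdist x A) \<partial>\<nu>) \<longlonglongrightarrow> measure \<nu> A"
    if "A \<in> ?E" "A \<noteq> {}" "prob_space \<nu>" "sets \<nu> = sets (restrict_space borel S)" for A \<nu>
  proof -
    interpret \<nu>: prob_space \<nu> by fact
    have [measurable]: "A \<in> sets \<nu>" using meas that by blast
    have "closed A" using that \<open>closed S\<close> by auto
    have [measurable]: "(\<lambda>x. max 0 (1 - real k * infdist x A)) \<in> borel_measurable \<nu>" for k
      unfolding measurable_cong_sets[OF that(4) refl]
      by (intro borel_measurable_continuous_on_restrict continuous_intros)
    have "(\<lambda>k. \<integral>x. max 0 (1 - real k * infdist x A) \<partial>\<nu>) \<longlonglongrightarrow> (\<integral>x. indicator A x \<partial>\<nu>)"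
    proof (rule integral_dominated_convergence[where w = "\<lambda>_. 1"])
      show "AE x in \<nu>. (\<lambda>k. max 0 (1 - real k * infdist x A)) \<longlonglongrightarrow> indicator A x"
      proof (rule AE_I2)
        fix x
        show "(\<lambda>k. max 0 (1 - real k * infdist x A)) \<longlonglongrightarrow> indicator A x"
        proof (cases "x \<in> A")
          case False
          then have "infdist x A > 0"
            using in_closed_iff_infdist_zero[OF \<open>closed A\<close> \<open>A \<noteq> {}\<close>] infdist_nonneg[of x A]
            by (metis less_eq_real_def)
          then obtain k0 where "1 / infdist x A \<le> real k0" using real_arch_simple by blast
          then have "max 0 (1 - real k * infdist x A) = 0" if "k \<ge> k0" for k
          proof -
            have "1 \<le> real k0 * infdist x A"
              using \<open>1 / infdist x A \<le> real k0\<close> \<open>infdist x A > 0\<close> by (simp add: field_simps)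
            also have "\<dots> \<le> real k * infdist x A" using that \<open>infdist x A > 0\<close> by (simp add: mult_right_mono)
            finally show ?thesis by simp
          qed
          then show ?thesis using False
            by (intro tendsto_eventually eventually_sequentiallyI[of k0]) simp
        qed simp
      qed
    qed (auto simp: infdist_nonneg)
    then show ?thesis by simp
  qed
  show ?thesis
  proof (rule measure_eqI_generator_eq[where E = ?E and \<Omega> = S and A = "\<lambda>_. S"])
    show "Int_stable ?E"
    proof (rule Int_stableI)
      fix a b assume "a \<in> ?E" "b \<in> ?E"
      then obtain a' b' where "a = S \<inter> a'" "b = S \<inter> b'" "closed a'" "closed b'" by auto
      then have "a \<inter> b = S \<inter> (a' \<inter> b')" "closed (a' \<inter> b')" by auto
      then show "a \<inter> b \<in> ?E" by blast
    qed
    fix A assume A: "A \<in> ?E"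
    show "emeasure \<mu> A = emeasure \<mu>' A"
    proof (cases "A = {}")
      case False
      have "(\<integral>x. max 0 (1 - real k * infdist x A) \<partial>\<mu>) = (\<integral>x. max 0 (1 - real k * infdist x A) \<partial>\<mu>')" for k
        by (intro eq continuous_intros)
      then have "measure \<mu> A = measure \<mu>' A"
        using lim[OF A False assms(2) sets(1)] lim[OF A False assms(3) sets(2)]
        by (simp add: LIMSEQ_unique)
      then show ?thesis by (simp add: \<mu>.emeasure_eq_measure \<mu>'.emeasure_eq_measure)
    qed simp
  qed (use sets gen in auto)
qed

text \<open>The construction of Krylov and Bogoliubov. The averages of \<open>g\<close> and of \<open>g \<circ> f\<close> along the same
  orbit segment differ only in the two end terms, so every weak limit is invariant.\<close>

theorem orbit_averages_subconverge_to_invariant_prob: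
  fixes S :: "'a::metric_space set" and N :: "nat \<Rightarrow> nat"
  assumes "compact S" "continuous_on S f" "f ` S \<subseteq> S"
    and N: "\<And>j. N j > 0" "filterlim N at_top sequentially" and x: "\<And>j. x j \<in> S"
  obtains r \<mu> where "strict_mono (r :: nat \<Rightarrow> nat)" "invariant_prob S f \<mu>"
    "\<And>g :: 'a \<Rightarrow> real. continuous_on S g \<Longrightarrow>
       (\<lambda>j. (\<Sum>i<N (r j). g ((f ^^ i) (x (r j)))) / real (N (r j))) \<longlonglongrightarrow> (\<integral>x. g x \<partial>\<mu>)"
proof -
  have orb: "(f ^^ i) y \<in> S" if "y \<in> S" for i y
    using that assms(3) by (induction i) auto
  obtain r \<mu> where r: "strict_mono (r :: nat \<Rightarrow> nat)" and "prob_space \<mu>"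
    and sets: "sets \<mu> = sets (restrict_space borel S)"
    and lim: "\<And>g :: 'a \<Rightarrow> real. continuous_on S g \<Longrightarrow>
       (\<lambda>j. (\<Sum>i<N (r j). g ((f ^^ i) (x (r j)))) / real (N (r j))) \<longlonglongrightarrow> (\<integral>x. g x \<partial>\<mu>)"
    using averages_subconverge_weakly[of S N "\<lambda>j i. (f ^^ i) (x j)"] assms(1) N(1) orb[OF x] by blast
  interpret \<mu>: prob_space \<mu> by fact
  have space: "space \<mu> = S"
    using sets_eq_imp_space_eq[OF sets] by (simp add: space_restrict_space)
  have "f \<in> measurable (restrict_space borel S) (restrict_space borel S)"
    using assms(2,3) by (intro measurable_restrict_space2 borel_measurable_continuous_on_restrict)
       (auto simp: space_restrict_space)
  then have f: "f \<in> measurable \<mu> \<mu>" by (simp add: measurable_cong_sets[OF sets sets])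
  have "distr \<mu> \<mu> f = \<mu>"
  proof (rule prob_space_eqI_continuous[OF assms(1)])
    show "prob_space (distr \<mu> \<mu> f)" by (rule \<mu>.prob_space_distr[OF f])
    fix g :: "'a \<Rightarrow> real" assume g: "continuous_on S g"
    have gm: "g \<in> borel_measurable \<mu>"
      using borel_measurable_continuous_on_restrict[OF g] by (simp add: measurable_cong_sets[OF sets refl])
    obtain B where B: "\<And>y. y \<in> S \<Longrightarrow> \<bar>g y\<bar> \<le> B"
      using compact_imp_bounded[OF compact_continuous_image[OF g assms(1)]] unfolding bounded_iff by auto
    have "continuous_on S (g \<circ> f)"
      using assms(2,3) by (intro continuous_on_compose continuous_on_subset[OF g]) auto
    note lim_gf = lim[OF this]
    have "(\<lambda>j. (\<Sum>i<N (r j). (g \<circ> f) ((f ^^ i) (x (r j)))) / real (N (r j))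
             - (\<Sum>i<N (r j). g ((f ^^ i) (x (r j)))) / real (N (r j))) \<longlonglongrightarrow> 0"
    proof (rule tendsto_rabs_zero_cancel, rule tendsto_sandwich[OF always_eventually always_eventually tendsto_const])
      show "\<forall>j. \<bar>(\<Sum>i<N (r j). (g \<circ> f) ((f ^^ i) (x (r j)))) / real (N (r j))
             - (\<Sum>i<N (r j). g ((f ^^ i) (x (r j)))) / real (N (r j))\<bar> \<le> 2 * B / real (N (r j))"
      proof
        fix j
        have "(\<Sum>i<N (r j). (g \<circ> f) ((f ^^ i) (x (r j)))) - (\<Sum>i<N (r j). g ((f ^^ i) (x (r j))))
            = g ((f ^^ N (r j)) (x (r j))) - g (x (r j))"
          using sum_lessThan_telescope[of "\<lambda>i. g ((f ^^ i) (x (r j)))" "N (r j)"]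
          by (simp add: sum_subtractf)
        also have "\<bar>\<dots>\<bar> \<le> 2 * B"
          using B[OF orb[OF x[of "r j"], of "N (r j)"]] B[OF x[of "r j"]] by linarith
        finally show "\<bar>(\<Sum>i<N (r j). (g \<circ> f) ((f ^^ i) (x (r j)))) / real (N (r j))
             - (\<Sum>i<N (r j). g ((f ^^ i) (x (r j)))) / real (N (r j))\<bar> \<le> 2 * B / real (N (r j))"
          by (simp add: diff_divide_distrib[symmetric] divide_right_mono)
      qed
      have "filterlim (\<lambda>j. N (r j)) at_top sequentially"
        using filterlim_compose[OF N(2) filterlim_subseq[OF r]] .
      then show "(\<lambda>j. 2 * B / real (N (r j))) \<longlonglongrightarrow> 0"
        by (intro tendsto_divide_0[OF tendsto_const] filterlim_at_top_imp_at_infinity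
              filterlim_compose[OF filterlim_real_sequentially])
    qed auto
    then have "(\<integral>x. (g \<circ> f) x \<partial>\<mu>) - (\<integral>x. g x \<partial>\<mu>) = 0"
      by (rule LIMSEQ_unique[OF tendsto_diff[OF lim_gf lim[OF g]]])
    then show "(\<integral>x. g x \<partial>distr \<mu> \<mu> f) = (\<integral>x. g x \<partial>\<mu>)"
      by (simp add: integral_distr[OF f gm])
  qed (use sets \<open>prob_space \<mu>\<close> in auto)
  then have "invariant_prob S f \<mu>"
    unfolding invariant_prob_def using \<open>prob_space \<mu>\<close> sets emeasure_distr[OF f] space by metis
  then show ?thesis using that[OF r] lim by blast
qed

section \<open>Slow drift from measures carried by fixed points\<close>

definition slowly_drifting :: "'a::metric_space set \<Rightarrow> ('a \<Rightarrow> 'a) \<Rightarrow> bool" where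
  "slowly_drifting S f \<longleftrightarrow> (\<forall>\<eta>>0. \<exists>N. \<forall>n\<ge>N. \<forall>x\<in>S.
     (\<Sum>i<n. dist ((f ^^ i) x) ((f ^^ Suc i) x)) \<le> \<eta> * real n)"

text \<open>Each point off the support has a null neighbourhood, and finitely many of these cover \<open>K\<close>.\<close>

lemma emeasure_compact_disjoint_support:
  assumes sets: "sets \<mu> = sets (restrict_space borel S)"
    and "compact K" "K \<subseteq> S" "K \<inter> measure_support S \<mu> = {}"
  shows "emeasure \<mu> K = 0"
proof -
  have "\<forall>x\<in>K. \<exists>T. open T \<and> x \<in> T \<and> emeasure \<mu> (S \<inter> T) = 0"
  proof
    fix x assume "x \<in> K"
    then have "x \<in> S" "x \<notin> measure_support S \<mu>" using assms by auto
    then obtain U where "openin (top_of_set S) U" "x \<in> U" "emeasure \<mu> U = 0"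
      unfolding measure_support_def by auto
    then show "\<exists>T. open T \<and> x \<in> T \<and> emeasure \<mu> (S \<inter> T) = 0"
      unfolding openin_open by auto
  qed
  then obtain T where T: "\<And>x. x \<in> K \<Longrightarrow> open (T x) \<and> x \<in> T x \<and> emeasure \<mu> (S \<inter> T x) = 0"
    by metis
  then have "\<And>x. x \<in> K \<Longrightarrow> open (T x)" "K \<subseteq> (\<Union>x\<in>K. T x)" by auto
  then obtain D where D: "D \<subseteq> K" "finite D" "K \<subseteq> (\<Union>x\<in>D. T x)"
    by (rule compactE_image[OF \<open>compact K\<close>])
  have "S \<inter> T x \<in> null_sets \<mu>" if "x \<in> D" for x
  proof -
    have x: "open (T x)" "emeasure \<mu> (S \<inter> T x) = 0" using T[of x] that D(1) by auto
    then have "S \<inter> T x \<in> sets \<mu>"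
      unfolding sets sets_restrict_space by (intro imageI borel_open)
    with x(2) show ?thesis by (rule null_setsI)
  qed
  then have null: "(\<Union>x\<in>D. S \<inter> T x) \<in> null_sets \<mu>"
    using D(2) by (intro null_sets_UN' countable_finite) auto
  then have "emeasure \<mu> K \<le> emeasure \<mu> (\<Union>x\<in>D. S \<inter> T x)"
    using D(3) \<open>K \<subseteq> S\<close> by (intro emeasure_mono) auto
  then show ?thesis using null by (simp add: null_sets_def)
qed

lemma integral_zero_if_support_in_zeros:
  fixes g :: "'a::metric_space \<Rightarrow> real"
  assumes "compact S" "continuous_on S g" and sets: "sets \<mu> = sets (restrict_space borel S)"
    and supp: "measure_support S \<mu> \<subseteq> {x \<in> S. g x = 0}"
  shows "(\<integral>x. g x \<partial>\<mu>) = 0"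
proof -
  define K where "K m = {x \<in> S. 1 / real (Suc m) \<le> \<bar>g x\<bar>}" for m
  have space: "space \<mu> = S"
    using sets_eq_imp_space_eq[OF sets] by (simp add: space_restrict_space)
  have "compact (K m)" for m
  proof -
    have "closedin (top_of_set S) (S \<inter> (\<lambda>x. \<bar>g x\<bar>) -` {1 / real (Suc m)..})"
      using assms(2) by (intro continuous_closedin_preimage continuous_intros) auto
    moreover have "S \<inter> (\<lambda>x. \<bar>g x\<bar>) -` {1 / real (Suc m)..} = K m" unfolding K_def by auto
    ultimately show ?thesis using assms(1) by (metis closedin_compact)
  qed
  then have null: "K m \<in> null_sets \<mu>" for m
  proof -
    have "K m \<in> sets \<mu>"
      using compact_imp_closed[OF \<open>compact (K m)\<close>] compact_imp_closed[OF assms(1)]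
      unfolding sets by (subst sets_restrict_space_iff) (auto simp: K_def)
    moreover have "emeasure \<mu> (K m) = 0"
      using supp by (intro emeasure_compact_disjoint_support[OF sets \<open>compact (K m)\<close>]) (auto simp: K_def)
    ultimately show ?thesis by blast
  qed
  have "AE x in \<mu>. x \<notin> (\<Union>m. K m)"
    by (intro AE_not_in null_sets_UN null)
  then have "AE x in \<mu>. g x = 0"
  proof (rule AE_mp, intro AE_I2 impI)
    fix x assume x: "x \<in> space \<mu>" "x \<notin> (\<Union>m. K m)"
    show "g x = 0"
    proof (rule ccontr)
      assume "g x \<noteq> 0"
      then obtain m where "1 / real (Suc m) < \<bar>g x\<bar>" using nat_approx_posE[of "\<bar>g x\<bar>"] by auto
      then have "x \<in> K m" using x(1) space unfolding K_def by simp
      then show False using x(2) by blast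
    qed
  qed
  then show ?thesis by (rule integral_eq_zero_AE)
qed

text \<open>Segments on which the displacement averages more than \<open>\<eta>\<close> would, if they existed with arbitrarily
  large length, accumulate at an invariant measure for which the displacement has integral at
  least \<open>\<eta>\<close>; but it vanishes on the support.\<close>

theorem slowly_drifting_if_invariant_measures_on_fixed_points:
  fixes S :: "'a::metric_space set"
  assumes "compact S" "continuous_on S f" "f ` S \<subseteq> S"
    and supp: "\<And>\<mu>. invariant_prob S f \<mu> \<Longrightarrow> measure_support S \<mu> \<subseteq> fixed_points S f"
  shows "slowly_drifting S f"
proof (rule ccontr)
  let ?g = "\<lambda>x. dist x (f x)"
  assume "\<not> slowly_drifting S f"
  then obtain \<eta> where "\<eta> > 0"
    and "\<not> (\<exists>N. \<forall>n\<ge>N. \<forall>x\<in>S. (\<Sum>i<n. dist ((f ^^ i) x) ((f ^^ Suc i) x)) \<le> \<eta> * real n)"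
    unfolding slowly_drifting_def by blast
  then have bad: "\<exists>n\<ge>N. \<exists>x\<in>S. \<eta> * real n < (\<Sum>i<n. ?g ((f ^^ i) x))" for N
    unfolding funpow.simps comp_apply by (meson not_le)
  have "\<exists>n x. Suc j \<le> n \<and> x \<in> S \<and> \<eta> * real n < (\<Sum>i<n. ?g ((f ^^ i) x))" for j
    using bad[of "Suc j"] by blast
  then obtain N x where N: "\<And>j. Suc j \<le> N j" and x: "\<And>j. x j \<in> S"
    and long: "\<And>j. \<eta> * real (N j) < (\<Sum>i<N j. ?g ((f ^^ i) (x j)))"
    by metis
  have pos: "N j > 0" for j using N[of j] by simp
  have "j \<le> N j" for j using N[of j] by simp
  then have lim_N: "filterlim N at_top sequentially"
    by (intro filterlim_at_top_mono[OF filterlim_ident always_eventually]) auto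
  obtain r :: "nat \<Rightarrow> nat" and \<mu> where "strict_mono r" "invariant_prob S f \<mu>"
    and lim: "\<And>g :: 'a \<Rightarrow> real. continuous_on S g \<Longrightarrow>
       (\<lambda>j. (\<Sum>i<N (r j). g ((f ^^ i) (x (r j)))) / real (N (r j))) \<longlonglongrightarrow> (\<integral>x. g x \<partial>\<mu>)"
    by (rule orbit_averages_subconverge_to_invariant_prob[where x = x, OF assms(1-3) pos lim_N x])
       (rule that, assumption, assumption, blast)
  have cont: "continuous_on S ?g" using assms(2) by (intro continuous_intros)
  have "(\<integral>x. ?g x \<partial>\<mu>) = 0"
    using supp[OF \<open>invariant_prob S f \<mu>\<close>] \<open>invariant_prob S f \<mu>\<close>
    by (intro integral_zero_if_support_in_zeros[OF assms(1) cont])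
       (auto simp: invariant_prob_def fixed_points_def)
  moreover have "\<eta> \<le> (\<integral>x. ?g x \<partial>\<mu>)"
  proof (rule LIMSEQ_le_const[OF lim[OF cont]], intro exI allI impI)
    show "\<eta> \<le> (\<Sum>i<N (r j). ?g ((f ^^ i) (x (r j)))) / real (N (r j))" for j
      using long[of "r j"] pos[of "r j"] by (simp add: field_simps)
  qed
  ultimately show False using \<open>\<eta> > 0\<close> by simp
qed

section \<open>Entropy of slowly drifting maps\<close>

fun switches :: "'a list \<Rightarrow> nat" where
  "switches (a # b # w) = (if a = b then 0 else 1) + switches (b # w)"
| "switches _ = 0"

text \<open>Weighting a word by \<open>y\<close> for each change of letter makes the total weight multiplicative: a further
  letter contributes \<open>1\<close> if it repeats the last one and \<open>y\<close> for each of the others.\<close>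

lemma sum_switches_weight:
  fixes y :: real
  assumes "finite P" "0 \<le> y"
  shows "(\<Sum>w | set w \<subseteq> P \<and> length w = n. y ^ switches (a # w)) \<le> (1 + real (card P) * y) ^ n"
proof (induction n arbitrary: a)
  case 0
  have "{w. set w \<subseteq> P \<and> length w = 0} = {[]}" by auto
  then show ?case by simp
next
  case (Suc n)
  let ?W = "{w. set w \<subseteq> P \<and> length w = n}" and ?k = "real (card P)"
  have "(\<Sum>w | set w \<subseteq> P \<and> length w = Suc n. y ^ switches (a # w))
      = (\<Sum>(w, b) \<in> ?W \<times> P. y ^ switches (a # b # w))"
    unfolding lists_length_Suc_eq
    by (subst sum.reindex) (auto simp: inj_on_def case_prod_unfold)
  also have "\<dots> = (\<Sum>b\<in>P. (if a = b then 1 else y) * (\<Sum>w\<in>?W. y ^ switches (b # w)))"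
    by (subst sum.cartesian_product[symmetric], subst sum.swap)
       (auto simp: sum_distrib_left intro!: sum.cong)
  also have "\<dots> \<le> (\<Sum>b\<in>P. (if a = b then 1 else y) * (1 + ?k * y) ^ n)"
    using Suc.IH assms by (intro sum_mono mult_left_mono) auto
  also have "\<dots> = (\<Sum>b\<in>P. if a = b then 1 else y) * (1 + ?k * y) ^ n"
    by (simp add: sum_distrib_right)
  also have "(\<Sum>b\<in>P. if a = b then 1 else y) \<le> (\<Sum>b\<in>P. (if a = b then 1 else 0) + y)"
    using assms by (intro sum_mono) auto
  also have "\<dots> \<le> 1 + ?k * y"
    using assms by (simp add: sum.distrib)
  finally show ?case using assms by (simp add: mult_right_mono)
qed

text \<open>Words with at most \<open>q\<close> changes weigh at least \<open>y powr q\<close> each, so the total weight bounds their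
  number. With \<open>q\<close> a small fraction of \<open>n\<close> this replaces an estimate of binomial coefficients.\<close>

lemma card_few_switches:
  fixes y q :: real
  assumes "finite P" "0 < y" "y \<le> 1" "W \<subseteq> {w. set w \<subseteq> P \<and> length w = n}"
    and few: "\<And>w. w \<in> W \<Longrightarrow> real (switches (a # w)) \<le> q"
  shows "real (card W) * y powr q \<le> (1 + real (card P) * y) ^ n"
proof -
  have fin: "finite {w. set w \<subseteq> P \<and> length w = n}" using assms(1) by (rule finite_lists_length_eq)
  have "real (card W) * y powr q = (\<Sum>w\<in>W. y powr q)" by simp
  also have "\<dots> \<le> (\<Sum>w\<in>W. y ^ switches (a # w))"
  proof (rule sum_mono)
    fix w assume "w \<in> W"
    then have "y powr q \<le> y powr real (switches (a # w))"
      using few assms by (intro powr_mono') auto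
    then show "y powr q \<le> y ^ switches (a # w)" using assms by (simp add: powr_realpow)
  qed
  also have "\<dots> \<le> (\<Sum>w | set w \<subseteq> P \<and> length w = n. y ^ switches (a # w))"
    using assms fin by (intro sum_mono2) auto
  also have "\<dots> \<le> (1 + real (card P) * y) ^ n"
    using assms by (intro sum_switches_weight) auto
  finally show ?thesis .
qed

text \<open>Follows a sequence of points by points \<open>near x\<close> of a net, starting from \<open>c\<close> and keeping the
  current net point as long as it is within distance \<open>2 * e\<close>. When \<open>near x\<close> is within \<open>e\<close> of \<open>x\<close>, the
  margin between \<open>e\<close> and \<open>2 * e\<close> is what makes replacements rare.\<close>

fun lazy_track :: "('a::metric_space \<Rightarrow> 'a) \<Rightarrow> real \<Rightarrow> 'a \<Rightarrow> 'a list \<Rightarrow> 'a list" where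
  "lazy_track near e c [] = []"
| "lazy_track near e c (x # xs) =
     (let c' = if dist x c \<le> 2 * e then c else near x in c' # lazy_track near e c' xs)"

fun path_length :: "'a::metric_space list \<Rightarrow> real" where
  "path_length (x # y # xs) = dist x y + path_length (y # xs)"
| "path_length _ = 0"

lemma length_lazy_track [simp]: "length (lazy_track near e c xs) = length xs"
  by (induction xs arbitrary: c) (auto simp: Let_def)

lemma set_lazy_track: "near ` set xs \<subseteq> P \<Longrightarrow> c \<in> P \<Longrightarrow> set (lazy_track near e c xs) \<subseteq> P"
  by (induction xs arbitrary: c) (auto simp: Let_def)

lemma lazy_track_close:
  assumes "\<And>x. x \<in> set xs \<Longrightarrow> dist x (near x) < e" "i < length xs"
  shows "dist (xs ! i) (lazy_track near e c xs ! i) \<le> 2 * e"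
  using assms
proof (induction xs arbitrary: c i)
  case (Cons x xs)
  have "e > 0" using Cons.prems(1)[of x] by (auto intro: le_less_trans[OF zero_le_dist])
  have "dist x (near x) \<le> 2 * e" using Cons.prems(1)[of x] \<open>e > 0\<close> by simp
  then show ?case using Cons.IH Cons.prems
    by (cases i) (auto simp: Let_def)
qed simp

text \<open>The quantity \<open>dist x c\<close> acts as a potential: it grows at most by the length of each step, and
  a replacement lowers it from above \<open>2 * e\<close> to below \<open>e\<close>, which pays for the replacement.\<close>

lemma switches_lazy_track:
  assumes "\<And>x. x \<in> set (x0 # xs) \<Longrightarrow> dist x (near x) < e"
  shows "e * switches (c # lazy_track near e c xs) \<le> path_length (x0 # xs) + dist x0 c"
  using assms
proof (induction xs arbitrary: x0 c)
  case (Cons x xs)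
  have "e > 0" using Cons.prems[of x] by (auto intro: le_less_trans[OF zero_le_dist])
  have near: "dist x (near x) < e" using Cons.prems by simp
  have IH: "e * switches (c' # lazy_track near e c' xs) \<le> path_length (x # xs) + dist x c'" for c'
    using Cons by simp
  have tri: "dist x c \<le> dist x0 x + dist x0 c" by (rule dist_triangle3)
  show ?case
  proof (cases "dist x c \<le> 2 * e")
    case True
    then show ?thesis using IH[of c] tri by simp
  next
    case False
    have "e * switches (c # lazy_track near e c (x # xs))
        \<le> e + e * switches (near x # lazy_track near e (near x) xs)"
      using False \<open>e > 0\<close> by (simp add: Let_def algebra_simps)
    then show ?thesis using IH[of "near x"] False tri near by simp
  qed
qed simp

definition orbit_segment :: "('a \<Rightarrow> 'a) \<Rightarrow> nat \<Rightarrow> 'a \<Rightarrow> 'a list" where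
  "orbit_segment f n x = map (\<lambda>i. (f ^^ i) x) [0..<n]"

lemma path_length_snoc: "path_length (xs @ [y]) = path_length xs + (if xs = [] then 0 else dist (last xs) y)"
  by (induction xs rule: path_length.induct) auto

lemma path_length_orbit_segment:
  "path_length (orbit_segment f n x) \<le> (\<Sum>i<n. dist ((f ^^ i) x) ((f ^^ Suc i) x))"
proof (cases n)
  case (Suc m)
  have snoc: "orbit_segment f (Suc k) x = orbit_segment f k x @ [(f ^^ k) x]" for k
    by (simp add: orbit_segment_def)
  have "path_length (orbit_segment f (Suc m) x) = (\<Sum>i<m. dist ((f ^^ i) x) ((f ^^ Suc i) x))"
  proof (induction m)
    case 0
    then show ?case by (simp add: orbit_segment_def)
  next
    case (Suc m)
    have "path_length (orbit_segment f (Suc (Suc m)) x)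
        = path_length (orbit_segment f (Suc m) x) + dist ((f ^^ m) x) ((f ^^ Suc m) x)"
      unfolding snoc[of "Suc m"] path_length_snoc by (simp add: snoc)
    then show ?case using Suc.IH by simp
  qed
  then show ?thesis using Suc by simp
qed (simp add: orbit_segment_def)

text \<open>Points with the same tracking word stay within \<open>4 * e\<close> of each other, so on a separated set
  the word determines the point. In the exponent \<open>q + 2\<close>, one unit pays for the distance of the
  first point from the net and one for a switch from the arbitrary letter \<open>a\<close> that is put in
  front of all words.\<close>

lemma card_separated_bound:
  fixes S :: "'a::metric_space set" and y e q :: real
  assumes "f ` S \<subseteq> S" and "finite P" "P \<noteq> {}" and net: "S \<subseteq> (\<Union>p\<in>P. ball p e)"
    and "0 < y" "y \<le> 1" "0 < e"
    and drift: "\<And>x. x \<in> S \<Longrightarrow> (\<Sum>i<n. dist ((f ^^ i) x) ((f ^^ Suc i) x)) \<le> e * q"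
    and sep: "separated_set S f n (4 * e) E"
  shows "real (card E) * y powr (q + 2) \<le> (1 + real (card P) * y) ^ n"
proof (cases "n = 0")
  case True
  then have "\<forall>x\<in>E. \<forall>z\<in>E. x = z" using sep unfolding separated_set_def by blast
  then have "card E \<le> 1" using card_le_Suc0_iff_eq[of E] by (cases "finite E") auto
  moreover have "y powr (q + 2) \<le> 1" if "x \<in> E" for x
  proof -
    have "0 \<le> e * q" using drift[of x] sep that True unfolding separated_set_def by auto
    then have "0 \<le> q" using \<open>0 < e\<close> by (simp add: zero_le_mult_iff)
    then show ?thesis using assms(5,6) by (intro powr_le1) auto
  qed
  ultimately show ?thesis
    using True mult_mono[of "real (card E)" 1 "y powr (q + 2)" 1] by (cases "E = {}") auto
next
  case False
  have "\<forall>x\<in>S. \<exists>p\<in>P. dist x p < e" using net by (auto simp: subset_iff dist_commute)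
  then obtain near where near: "\<And>x. x \<in> S \<Longrightarrow> near x \<in> P \<and> dist x (near x) < e" by metis
  obtain a where "a \<in> P" using \<open>P \<noteq> {}\<close> by blast
  define code where "code x = lazy_track near e (near x) (orbit_segment f n x)" for x
  have orb: "(f ^^ i) x \<in> S" if "x \<in> S" for i x
    using that assms(1) by (induction i) auto
  have seg: "set (orbit_segment f n x) \<subseteq> S" if "x \<in> S" for x
    using orb that unfolding orbit_segment_def by auto
  have ES: "E \<subseteq> S" using sep unfolding separated_set_def by blast
  have "inj_on code E"
  proof (rule inj_onI)
    fix x z assume xz: "x \<in> E" "z \<in> E" "code x = code z"
    have "dist ((f ^^ i) x) ((f ^^ i) z) \<le> 4 * e" if "i < n" for i
    proof -
      have close: "dist ((f ^^ i) u) (code u ! i) \<le> 2 * e" if "u \<in> E" for u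
      proof -
        have "u \<in> S" using ES that by blast
        then have "dist (orbit_segment f n u ! i) (code u ! i) \<le> 2 * e"
          unfolding code_def using near seg \<open>i < n\<close>
          by (intro lazy_track_close) (auto simp: orbit_segment_def subset_iff)
        then show ?thesis using \<open>i < n\<close> by (simp add: orbit_segment_def)
      qed
      show ?thesis using close[of x] close[of z] xz dist_triangle2[of "(f ^^ i) x" "(f ^^ i) z" "code x ! i"]
        by simp
    qed
    then show "x = z" using sep xz unfolding separated_set_def by (metis not_less)
  qed
  then have "card E = card (code ` E)" by (simp add: card_image)
  moreover have "real (card (code ` E)) * y powr (q + 2) \<le> (1 + real (card P) * y) ^ n"
  proof (rule card_few_switches[OF assms(2,5,6), where a = a])
    show "code ` E \<subseteq> {w. set w \<subseteq> P \<and> length w = n}"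
    proof clarsimp
      fix x assume "x \<in> E"
      then have "x \<in> S" using ES by blast
      then have "set (code x) \<subseteq> P" unfolding code_def
        using near seg by (intro set_lazy_track) (auto simp: image_subset_iff subset_iff)
      then show "set (code x) \<subseteq> P \<and> length (code x) = n" by (simp add: code_def orbit_segment_def)
    qed
    fix w assume "w \<in> code ` E"
    then obtain x where x: "x \<in> S" "w = code x" using ES by blast
    obtain xs where xs: "orbit_segment f n x = x # xs"
      using False by (cases n) (auto simp: orbit_segment_def upt_conv_Cons simp del: upt_Suc)
    have "e * switches (near x # lazy_track near e (near x) xs) \<le> path_length (x # xs) + dist x (near x)"
      using xs seg[OF x(1)] near by (intro switches_lazy_track) auto
    also have "path_length (x # xs) \<le> e * q"
      using path_length_orbit_segment[of f n x] drift[OF x(1)] xs by simp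
    also have "dist x (near x) \<le> e" using near x by force
    finally have "e * switches (near x # lazy_track near e (near x) xs) \<le> e * (q + 1)"
      by (simp add: algebra_simps)
    then have "switches (near x # lazy_track near e (near x) xs) \<le> q + 1"
      using \<open>0 < e\<close> by simp
    moreover have "w = near x # lazy_track near e (near x) xs"
      using x xs near[OF x(1)] \<open>0 < e\<close> by (simp add: code_def Let_def)
    ultimately show "real (switches (a # w)) \<le> q + 2" by simp
  qed
  ultimately show ?thesis by simp
qed

text \<open>By \<open>card_separated_bound\<close> the exponential growth rate is at most \<open>ln (1 + k * y) + \<theta> * ln (1 / y)\<close>,
  where \<open>k\<close> is the size of a net fixed by \<open>\<epsilon>\<close> and \<open>\<theta>\<close> is the proportion of switches. First \<open>y\<close> and
  then \<open>\<theta>\<close> are chosen so small that both terms are at most a third of \<open>\<gamma>\<close>; the remaining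
  third absorbs the two extra switches, which count less and less as \<open>n\<close> grows.\<close>

lemma entropy_at_scale_le:
  fixes S :: "'a::metric_space set"
  assumes "compact S" "f ` S \<subseteq> S" "S \<noteq> {}" "slowly_drifting S f" "0 < \<epsilon>" "0 < \<gamma>"
  shows "entropy_at_scale S f \<epsilon> \<le> ereal \<gamma>"
proof -
  define e where "e = \<epsilon> / 4"
  have "e > 0" using assms unfolding e_def by simp
  then obtain P where P: "finite P" "S \<subseteq> (\<Union>p\<in>P. ball p e)"
    using assms(1) unfolding compact_eq_totally_bounded by blast
  then have "P \<noteq> {}" using \<open>S \<noteq> {}\<close> by auto
  define k where "k = real (card P)"
  have "k > 0" using P \<open>P \<noteq> {}\<close> unfolding k_def by (simp add: card_gt_0_iff)
  define y where "y = min (1 / 2) (\<gamma> / (3 * k))"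
  have y: "0 < y" "y < 1" "k * y \<le> \<gamma> / 3"
    using \<open>k > 0\<close> \<open>\<gamma> > 0\<close> unfolding y_def by (auto simp: min_def field_simps)
  define l where "l = ln (1 / y)"
  have "l > 0" using y unfolding l_def by simp
  define \<theta> where "\<theta> = \<gamma> / (3 * l)"
  have "\<theta> > 0" using \<open>l > 0\<close> \<open>\<gamma> > 0\<close> unfolding \<theta>_def by simp
  then have "e * \<theta> > 0" using \<open>e > 0\<close> by simp
  then obtain N where N: "\<And>n x. n \<ge> N \<Longrightarrow> x \<in> S \<Longrightarrow>
      (\<Sum>i<n. dist ((f ^^ i) x) ((f ^^ Suc i) x)) \<le> e * \<theta> * real n"
    using assms(4)[unfolded slowly_drifting_def, rule_format, OF \<open>e * \<theta> > 0\<close>] by blast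
  obtain N' where N': "real N' \<ge> 6 * l / \<gamma>" using real_arch_simple by blast
  have bound: "ln (real (card E)) / real n \<le> \<gamma>"
    if n: "n \<ge> max N (max N' 1)" and E: "finite E" "E \<noteq> {}" "separated_set S f n \<epsilon> E" for n E
  proof -
    have "real (card E) * y powr (\<theta> * real n + 2) \<le> (1 + real (card P) * y) ^ n"
      using assms P \<open>P \<noteq> {}\<close> y \<open>e > 0\<close> N[of n] n E
      by (intro card_separated_bound[where e = e and f = f and S = S]) (auto simp: e_def mult_ac)
    then have "real (card E) * y powr (\<theta> * real n + 2) \<le> (1 + k * y) ^ n" unfolding k_def .
    moreover have "card E > 0" using E by (simp add: card_gt_0_iff)
    ultimately have "ln (real (card E) * y powr (\<theta> * real n + 2)) \<le> ln ((1 + k * y) ^ n)"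
      using y \<open>k > 0\<close> by (subst ln_le_cancel_iff) (auto intro!: mult_pos_pos zero_less_power add_pos_pos)
    moreover have "ln (real (card E) * y powr (\<theta> * real n + 2)) = ln (real (card E)) - (\<theta> * real n + 2) * l"
      using y \<open>card E > 0\<close> by (simp add: ln_mult ln_powr l_def ln_div)
    moreover have "ln ((1 + k * y) ^ n) \<le> real n * (k * y)"
      using y \<open>k > 0\<close> ln_add_one_self_le_self[of "k * y"] by (simp add: ln_realpow mult_left_mono)
    moreover have "real n * (k * y) \<le> real n * (\<gamma> / 3)" using y by (intro mult_left_mono) auto
    moreover have "(\<theta> * real n + 2) * l = real n * (\<gamma> / 3) + 2 * l"
      using \<open>l > 0\<close> unfolding \<theta>_def by (simp add: field_simps)
    moreover have "2 * l \<le> real n * (\<gamma> / 3)"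
    proof -
      have "6 * l / \<gamma> \<le> real n" using N' n by linarith
      then show ?thesis using \<open>\<gamma> > 0\<close> by (simp add: field_simps)
    qed
    ultimately have "ln (real (card E)) \<le> real n * \<gamma>" by simp
    then show ?thesis using n by (simp add: field_simps)
  qed
  have "\<forall>\<^sub>F n in sequentially.
      (SUP E \<in> {E. finite E \<and> E \<noteq> {} \<and> separated_set S f n \<epsilon> E}. ereal (ln (real (card E)) / real n)) \<le> ereal \<gamma>"
    using bound by (intro eventually_sequentiallyI[of "max N (max N' 1)"] SUP_least) auto
  then show ?thesis unfolding entropy_at_scale_def by (rule Limsup_bounded)
qed

theorem topological_entropy_eq_0:
  fixes S :: "'a::metric_space set"
  assumes "compact S" "f ` S \<subseteq> S" "S \<noteq> {}" "slowly_drifting S f"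
  shows "topological_entropy S f = 0"
proof (rule antisym)
  show "topological_entropy S f \<le> 0"
    unfolding topological_entropy_def
  proof (rule SUP_least)
    fix \<epsilon> :: real assume "\<epsilon> \<in> {0<..}"
    then show "entropy_at_scale S f \<epsilon> \<le> 0"
      using entropy_at_scale_le[OF assms, of \<epsilon>] by (simp add: ereal_le_epsilon2)
  qed
  obtain x where "x \<in> S" using assms by blast
  have "0 \<le> (SUP E \<in> {E. finite E \<and> E \<noteq> {} \<and> separated_set S f n 1 E}. ereal (ln (real (card E)) / real n))" for n
    using \<open>x \<in> S\<close> by (intro SUP_upper2[of "{x}"]) (auto simp: separated_set_def)
  then have "0 \<le> entropy_at_scale S f 1"
    unfolding entropy_at_scale_def by (intro le_Limsup) auto
  also have "\<dots> \<le> topological_entropy S f"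
    unfolding topological_entropy_def by (intro SUP_upper) auto
  finally show "0 \<le> topological_entropy S f" .
qed

section \<open>Fixed and periodic points of slowly drifting maps\<close>

text \<open>Let \<open>z\<close> minimize the displacement on \<open>K\<close>. Along the orbit of \<open>z\<close>, which stays in \<open>K\<close>, the
  displacement is at least that of \<open>z\<close>, whereas its averages tend to \<open>0\<close>.\<close>

lemma slowly_drifting_fixed_point:
  fixes S :: "'a::metric_space set"
  assumes drift: "slowly_drifting S f" and "continuous_on S f"
    and K: "compact K" "K \<subseteq> S" "K \<noteq> {}" "f ` K \<subseteq> K"
  obtains x where "x \<in> K" "f x = x"
proof -
  have "continuous_on K (\<lambda>x. dist x (f x))"
    using continuous_on_subset[OF assms(2) K(2)] by (intro continuous_intros)
  then obtain z where "z \<in> K" and min: "\<And>y. y \<in> K \<Longrightarrow> dist z (f z) \<le> dist y (f y)"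
    using continuous_attains_inf[OF K(1,3)] by blast
  have orb: "(f ^^ i) z \<in> K" for i using \<open>z \<in> K\<close> K(4) by (induction i) auto
  have "f z = z"
  proof (rule ccontr)
    assume "f z \<noteq> z"
    then have "dist z (f z) / 2 > 0" by simp
    then obtain N where N: "\<And>n x. n \<ge> N \<Longrightarrow> x \<in> S \<Longrightarrow>
        (\<Sum>i<n. dist ((f ^^ i) x) ((f ^^ Suc i) x)) \<le> dist z (f z) / 2 * real n"
      using drift unfolding slowly_drifting_def by blast
    have "real (Suc N) * dist z (f z) = (\<Sum>i<Suc N. dist z (f z))" by simp
    also have "\<dots> \<le> (\<Sum>i<Suc N. dist ((f ^^ i) z) ((f ^^ Suc i) z))"
      using min[OF orb] by (intro sum_mono) auto
    also have "\<dots> \<le> dist z (f z) / 2 * real (Suc N)"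
      using N[of "Suc N" z] \<open>z \<in> K\<close> K(2) by auto
    finally show False using \<open>dist z (f z) / 2 > 0\<close> by simp
  qed
  then show ?thesis using that \<open>z \<in> K\<close> by blast
qed

lemma funpow_fixed: "f x = x \<Longrightarrow> (f ^^ k) x = x"
  by (induction k) auto

text \<open>A periodic orbit is a compact invariant set, so it contains a fixed point and thus reduces to it.\<close>

lemma slowly_drifting_periodic_points:
  assumes drift: "slowly_drifting S f" and cont: "continuous_on S f" and "f ` S \<subseteq> S"
  shows "periodic_points S f = fixed_points S f"
proof
  show "fixed_points S f \<subseteq> periodic_points S f"
    unfolding fixed_points_def periodic_points_def by (auto intro: exI[of _ 1])
  show "periodic_points S f \<subseteq> fixed_points S f"
  proof
    fix x assume "x \<in> periodic_points S f"
    then obtain k where k: "x \<in> S" "k > 0" "(f ^^ k) x = x" unfolding periodic_points_def by blast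
    let ?K = "(\<lambda>i. (f ^^ i) x) ` {..<k}"
    have orb: "(f ^^ i) x \<in> S" for i using k(1) assms(3) by (induction i) auto
    have "f ((f ^^ i) x) \<in> ?K" if "i < k" for i
    proof (cases "Suc i = k")
      case True
      then have "f ((f ^^ i) x) = (f ^^ 0) x" using k(3) by auto
      then show ?thesis using k(2) by blast
    next
      case False
      then have "Suc i \<in> {..<k}" using that by simp
      then have "(f ^^ Suc i) x \<in> ?K" by (rule imageI)
      then show ?thesis by simp
    qed
    then have "f ` ?K \<subseteq> ?K" by blast
    moreover have "compact ?K" by (simp add: finite_imp_compact)
    ultimately obtain z where "z \<in> ?K" and fz: "f z = z"
      using slowly_drifting_fixed_point[OF drift cont, of ?K] orb k(2) by auto
    then obtain i where i: "i < k" "z = (f ^^ i) x" by auto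
    have "x = (f ^^ (k - i)) z"
      using i k(3) funpow_add[of "k - i" i f] by simp
    then have "x = z" using funpow_fixed[of f z "k - i", OF fz] by simp
    then show "x \<in> fixed_points S f" using k(1) fz by (simp add: fixed_points_def)
  qed
qed

section \<open>Minimal sets in terms of generators\<close>

text \<open>Unlike the inclusion \<open>g ` K \<subseteq> K\<close>, the equality \<open>g ` K = K\<close> passes to the inverse of an injection, so it
  extends from the generators to the group.\<close>

lemma generated_homeos_invariant_iff:
  assumes bij: "\<And>g. g \<in> F \<Longrightarrow> bij_betw g S S" and "K \<subseteq> S"
  shows "invariant_under (generated_homeos S F) K \<longleftrightarrow> (\<forall>g\<in>F. g ` K = K)"
proof -
  have restr: "restrict g S ` K = g ` K" for g :: "'a \<Rightarrow> 'a"
    using \<open>K \<subseteq> S\<close> by (intro image_cong) auto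
  show ?thesis
  proof
    assume inv: "invariant_under (generated_homeos S F) K"
    show "\<forall>g\<in>F. g ` K = K"
    proof
      fix g assume "g \<in> F"
      then have "restrict g S \<in> generated_homeos S F"
        unfolding generated_homeos_def by (intro generate.incl imageI)
      then have "restrict g S ` K = K" using inv unfolding invariant_under_def by blast
      then show "g ` K = K" unfolding restr .
    qed
  next
    assume F: "\<forall>g\<in>F. g ` K = K"
    have rBij: "restrict g S \<in> Bij S" if "g \<in> F" for g
      using bij[OF that] unfolding Bij_def by (simp add: bij_betw_cong[of S "restrict g S" g])
    have rimg: "restrict g S ` K = K" if "g \<in> F" for g
      using F that unfolding restr by blast
    have "g \<in> Bij S \<and> g ` K = K" if "g \<in> generate (BijGroup S) ((\<lambda>g. restrict g S) ` F)" for g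
      using that
    proof induction
      case one
      have "\<one>\<^bsub>BijGroup S\<^esub> = restrict (\<lambda>x. x) S" by (simp add: BijGroup_def)
      moreover have "restrict (\<lambda>x. x) S ` K = K" unfolding restr by simp
      ultimately show ?case using id_Bij[of S] by metis
    next
      case (incl g)
      then show ?case using rBij rimg by blast
    next
      case (inv g)
      then have g: "g \<in> Bij S" "g ` K = K" using rBij rimg by blast+
      then have "inv_into S g ` K = K"
        using inv_into_image_cancel[of g S K] \<open>K \<subseteq> S\<close> unfolding Bij_def bij_betw_def by auto
      then have "restrict (inv_into S g) S ` K = K" unfolding restr .
      then show ?case using inv_BijGroup[OF g(1)] restrict_inv_into_Bij[OF g(1)] by metis
    next
      case (eng g1 g2)
      have "compose S g1 g2 ` K = g1 ` g2 ` K"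
        unfolding compose_def restr by (simp add: image_image)
      moreover have "g1 \<otimes>\<^bsub>BijGroup S\<^esub> g2 = compose S g1 g2"
        using eng.IH by (simp add: BijGroup_def)
      ultimately show ?case using eng.IH compose_Bij[of g1 S g2] by simp
    qed
    then show "invariant_under (generated_homeos S F) K"
      unfolding invariant_under_def generated_homeos_def by blast
  qed
qed

lemma homeomorphism_bij_betw:
  assumes "homeomorphism S S f f'"
  shows "bij_betw f S S"
  using assms by (intro bij_betwI[of _ _ _ f']) (auto simp: homeomorphism_def)

lemma minimal_set_generated_homeos_iff:
  assumes "\<And>g. g \<in> F \<Longrightarrow> bij_betw g S S"
  shows "minimal_set S (generated_homeos S F) M \<longleftrightarrow>
     M \<noteq> {} \<and> closedin (top_of_set S) M \<and> (\<forall>g\<in>F. g ` M = M) \<and>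
     (\<forall>K. K \<subseteq> M \<and> closedin (top_of_set S) K \<and> (\<forall>g\<in>F. g ` K = K) \<longrightarrow> K = M \<or> K = {})"
proof -
  have "invariant_under (generated_homeos S F) K \<longleftrightarrow> (\<forall>g\<in>F. g ` K = K)"
    if "closedin (top_of_set S) K" for K
    using generated_homeos_invariant_iff[OF assms] closedin_subset[OF that] by simp
  then show ?thesis unfolding minimal_set_def by (simp cong: conj_cong)
qed

section \<open>Representations of Baumslag--Solitar groups\<close>

theorem theorem5:
  fixes S :: "'a::metric_space set"
    and f f' h h' :: "'a \<Rightarrow> 'a"
    and n :: nat
  assumes "n \<ge> 2"
    and "closed_surface S" and "orientable S"
    and "homeomorphism S S f f'" and "homeomorphism S S h h'"
    and "\<And>x. x \<in> S \<Longrightarrow> (h \<circ> f \<circ> h') x = (f ^^ n) x"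
    and "\<And>\<mu>. invariant_prob S f \<mu> \<Longrightarrow> measure_support S \<mu> \<subseteq> fixed_points S f"
  shows "((\<forall>M. minimal_set S (generated_homeos S {f}) M \<longrightarrow> (\<exists>x\<in>S. M = {x} \<and> f x = x)) \<and>
          periodic_points S f = fixed_points S f) \<and>
         (\<forall>M. minimal_set S (generated_homeos S {f, h}) M \<longrightarrow>
            M \<subseteq> fixed_points S f \<and> minimal_set S (generated_homeos S {h}) M) \<and>
         topological_entropy S f = 0"
proof -
  have S: "compact S" "S \<noteq> {}" using assms(2) by (auto simp: closed_surface_def)
  have f: "continuous_on S f" "f ` S = S" and fbij: "bij_betw f S S"
    using assms(4) homeomorphism_bij_betw by (auto simp: homeomorphism_def)
  have h: "h ` S = S" "h' ` S = S" "\<And>x. x \<in> S \<Longrightarrow> h' (h x) = x" "\<And>x. x \<in> S \<Longrightarrow> h (h' x) = x"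
    and hbij: "bij_betw h S S"
    using assms(5) homeomorphism_bij_betw by (auto simp: homeomorphism_def)
  have drift: "slowly_drifting S f"
    using slowly_drifting_if_invariant_measures_on_fixed_points[OF S(1) f(1)] f(2) assms(7) by blast
  have per: "periodic_points S f = fixed_points S f"
    using slowly_drifting_periodic_points[OF drift f(1)] f(2) by blast
  have ent: "topological_entropy S f = 0"
    using topological_entropy_eq_0[OF S(1) _ S(2) drift] f(2) by blast
  have fixed_in: "\<exists>x\<in>M. f x = x" if "closedin (top_of_set S) M" "M \<noteq> {}" "f ` M = M" for M
    using slowly_drifting_fixed_point[OF drift f(1), of M] closedin_compact[OF S(1) that(1)]
      closedin_subset[OF that(1)] that by auto

  have min_f: "\<exists>x\<in>S. M = {x} \<and> f x = x" if M: "minimal_set S (generated_homeos S {f}) M" for M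
  proof -
    have bij: "\<And>g. g \<in> {f} \<Longrightarrow> bij_betw g S S" using fbij by blast
    note M' = iffD1[OF minimal_set_generated_homeos_iff M, OF bij]
    then have cl: "closedin (top_of_set S) M" and ne: "M \<noteq> {}" and fM: "f ` M = M"
      and min: "\<And>K. K \<subseteq> M \<Longrightarrow> closedin (top_of_set S) K \<Longrightarrow> f ` K = K \<Longrightarrow> K = M \<or> K = {}"
      by auto
    obtain x where x: "x \<in> M" "f x = x" using fixed_in[OF cl ne fM] by blast
    then have "x \<in> S" using closedin_subset[OF cl] by auto
    then have "closedin (top_of_set S) {x}" by (simp add: closed_subset)
    then have "M = {x}" using min[of "{x}"] x by simp
    then show ?thesis using x \<open>x \<in> S\<close> by blast
  qed

  \<comment> \<open>For a fixed point \<open>x\<close>, the relation gives \<open>f^n (h x) = h (f x) = h x\<close>, so \<open>h x\<close> is periodic, hence fixed.\<close>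
  have hFix: "h x \<in> fixed_points S f" if "x \<in> fixed_points S f" for x
  proof -
    have x: "x \<in> S" "f x = x" and "h x \<in> S" using that h(1) by (auto simp: fixed_points_def)
    then have "(f ^^ n) (h x) = h x" using assms(6)[of "h x"] h(3) by simp
    then have "h x \<in> periodic_points S f"
      using \<open>h x \<in> S\<close> assms(1) unfolding periodic_points_def by (auto intro!: exI[of _ n])
    then show ?thesis by (simp add: per)
  qed
  \<comment> \<open>Conversely \<open>h (f (h' x)) = f^n x = x\<close> gives \<open>f (h' x) = h' x\<close> directly.\<close>
  have h'Fix: "h' x \<in> fixed_points S f" if "x \<in> fixed_points S f" for x
  proof -
    have x: "x \<in> S" "f x = x" and "h' x \<in> S" using that h(2) by (auto simp: fixed_points_def)
    then have "h (f (h' x)) = x" using assms(6)[of x] funpow_fixed[of f x n] by simp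
    moreover have "f (h' x) \<in> S" using f(2) \<open>h' x \<in> S\<close> by blast
    ultimately have "f (h' x) = h' x" using h(3) by metis
    then show ?thesis using \<open>h' x \<in> S\<close> by (simp add: fixed_points_def)
  qed

  have fixed_image: "f ` K = K" if "K \<subseteq> fixed_points S f" for K
  proof -
    have "f ` K = (\<lambda>x. x) ` K" using that by (intro image_cong) (auto simp: fixed_points_def)
    then show ?thesis by simp
  qed
  have min_fh: "M \<subseteq> fixed_points S f \<and> minimal_set S (generated_homeos S {h}) M"
    if M: "minimal_set S (generated_homeos S {f, h}) M" for M
  proof -
    have bij: "\<And>g. g \<in> {f, h} \<Longrightarrow> bij_betw g S S" using fbij hbij by blast
    note M' = iffD1[OF minimal_set_generated_homeos_iff M, OF bij]
    then have cl: "closedin (top_of_set S) M" and ne: "M \<noteq> {}" and fM: "f ` M = M" and hM: "h ` M = M"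
      and min: "\<And>K. K \<subseteq> M \<Longrightarrow> closedin (top_of_set S) K \<Longrightarrow> f ` K = K \<Longrightarrow> h ` K = K \<Longrightarrow> K = M \<or> K = {}"
      by auto
    have MS: "M \<subseteq> S" using closedin_subset[OF cl] by simp
    let ?K = "M \<inter> fixed_points S f"
    have "continuous_on S (\<lambda>x. dist (f x) x)" using f(1) by (intro continuous_intros)
    then have "closedin (top_of_set S) (S \<inter> (\<lambda>x. dist (f x) x) -` {0})"
      by (rule continuous_closedin_preimage) simp
    moreover have "S \<inter> (\<lambda>x. dist (f x) x) -` {0} = fixed_points S f" by (auto simp: fixed_points_def)
    ultimately have "closedin (top_of_set S) ?K" using cl by (simp add: closedin_Int)
    moreover have "f ` ?K = ?K"
      by (rule fixed_image) simp
    moreover have "h ` ?K = ?K"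
    proof
      show "h ` ?K \<subseteq> ?K" using hM hFix by blast
      show "?K \<subseteq> h ` ?K"
      proof
        fix x assume x: "x \<in> ?K"
        then obtain y where y: "y \<in> M" "x = h y" using hM by blast
        then have "y = h' x" using h(3) MS by auto
        then show "x \<in> h ` ?K" using y x h'Fix by blast
      qed
    qed
    moreover have "?K \<noteq> {}" using fixed_in[OF cl ne fM] MS by (auto simp: fixed_points_def)
    ultimately have "?K = M" using min[of ?K] by blast
    then have fix_M: "M \<subseteq> fixed_points S f" by blast
    have "K = M \<or> K = {}" if K: "K \<subseteq> M" "closedin (top_of_set S) K" "h ` K = K" for K
    proof -
      have "f ` K = K"
        using fix_M K(1) by (intro fixed_image) simp
      then show ?thesis using min K by blast
    qed
    then have "minimal_set S (generated_homeos S {h}) M"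
      using cl ne hM by (subst minimal_set_generated_homeos_iff) (auto simp: hbij)
    then show ?thesis using fix_M by blast
  qed
  show ?thesis using min_f per min_fh ent by blast
qed

end
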